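(* For all $n$ such that $K_n$ contains the relevant graph: (a) ${\mathcal M}_{f_{1,1}}(K_n)$ is the unique maximal $K_3$-matroid on $K_n$ and its rank function is ${\rm val}_{K_3}$; (b) ${\mathcal M}_{f_{2,3}}(K_n)$ is the unique maximal $K_4$-matroid on $K_n$ and its rank function is ${\rm val}_{K_4}$; (c) ${\mathcal M}_{f_{1,0}}(K_n)$ is the unique maximal $K_4^-$-matroid on $K_n$ and its rank function is ${\rm val}_{K_4^-}$; (d) ${\mathcal M}_{f_{2,2}}(K_n)$ is the unique maximal $K_5^-$-matroid on $K_n$ and its rank function is ${\rm val}_{K_5^-}$; (e) ${\mathcal M}_{f_{3,5}}(K_n)$ is the unique maximal $K_6^-$-matroid on $K_n$ and its rank function is ${\rm val}_{K_6^-}$.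
   Context: For integers $a\ge0$, $b$, let $f_{a,b}(F)=a|V(F)|-b$ for $F\subseteq E(K_n)$, where $V(F)$ is the set of vertices incident to $F$. ${\mathcal M}_{f_{a,b}}(K_n)$ is the matroid on $E(K_n)$ whose independent sets are those $F$ with $|I|\le f_{a,b}(I)$ for every nonempty $I\subseteq F$ (Edmonds' matroid induced by a non-decreasing submodular function). $K_m^-$ is $K_m$ minus one edge. An $H$-matroid on $K_n$ is a matroid on $E(K_n)$ in which the edge set of every subgraph isomorphic to $H$ is a circuit; maximality is in the weak order (${\mathcal M}_1\preceq{\mathcal M}_2$ if every independent set of ${\mathcal M}_1$ is independent in ${\mathcal M}_2$). For ${\mathcal X}$ the family of edge sets of copies of $H$ in $K_n$, a proper ${\mathcal X}$-sequence is $(X_1,\dots,X_m)$ in ${\mathcal X}$ with $X_i\not\subseteq\bigcup_{j<i}X_j$ for $i\ge2$; ${\rm val}(F,{\mathcal S})=|F\cup\bigcup_iX_i|-m$ and ${\rm val}_H(F)=\min_{\mathcal S}{\rm val}(F,{\mathcal S})$. *)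

theory Defs
  imports Main
begin

section \<open>Matroids\<close>

locale matroid =
  fixes carrier :: "'a set" and indep :: "'a set \<Rightarrow> bool"
  assumes carrier_finite: "finite carrier"
    and indep_subset_carrier: "indep X \<Longrightarrow> X \<subseteq> carrier"
    and indep_empty: "indep {}"
    and indep_subset: "indep X \<Longrightarrow> Y \<subseteq> X \<Longrightarrow> indep Y"
    and indep_augment: "indep X \<Longrightarrow> indep Y \<Longrightarrow> card Y < card X \<Longrightarrow> \<exists>x\<in>X - Y. indep (insert x Y)"

definition is_circuit :: "'a set \<Rightarrow> ('a set \<Rightarrow> bool) \<Rightarrow> 'a set \<Rightarrow> bool" where
  "is_circuit E indep C \<longleftrightarrow> C \<subseteq> E \<and> \<not> indep C \<and> (\<forall>D. D \<subset> C \<longrightarrow> indep D)"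

definition matroid_rank :: "('a set \<Rightarrow> bool) \<Rightarrow> 'a set \<Rightarrow> nat" where
  "matroid_rank indep F = Max {card I | I. I \<subseteq> F \<and> indep I}"

definition weak_le :: "('a set \<Rightarrow> bool) \<Rightarrow> ('a set \<Rightarrow> bool) \<Rightarrow> bool" where
  "weak_le indep\<^sub>1 indep\<^sub>2 \<longleftrightarrow> (\<forall>X. indep\<^sub>1 X \<longrightarrow> indep\<^sub>2 X)"


section \<open>Graphs\<close>

text \<open>A simple graph is a pair of a vertex set and a set of two-element subsets of it.\<close>

type_synonym 'v graph = "'v set \<times> 'v set set"

definition verts :: "'v graph \<Rightarrow> 'v set" where "verts G = fst G"

definition edges :: "'v graph \<Rightarrow> 'v set set" where "edges G = snd G"

definition complete_graph :: "nat \<Rightarrow> nat graph" where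
  "complete_graph n = ({..<n}, {{u, v} | u v. u < n \<and> v < n \<and> u \<noteq> v})"

definition complete_graph_minus_edge :: "nat \<Rightarrow> nat graph" where
  "complete_graph_minus_edge m =
     (verts (complete_graph m), edges (complete_graph m) - {{0, 1}})"

definition simple_graph :: "'v graph \<Rightarrow> bool" where
  "simple_graph G \<longleftrightarrow> (\<forall>e\<in>edges G. e \<subseteq> verts G \<and> card e = 2)"

definition subgraph :: "'v graph \<Rightarrow> 'v graph \<Rightarrow> bool" where
  "subgraph G' G \<longleftrightarrow> simple_graph G' \<and> verts G' \<subseteq> verts G \<and> edges G' \<subseteq> edges G"

definition graph_isomorphic :: "'v graph \<Rightarrow> 'w graph \<Rightarrow> bool" where
  "graph_isomorphic G H \<longleftrightarrow>
     (\<exists>\<phi>. bij_betw \<phi> (verts G) (verts H) \<and> edges H = (\<lambda>e. \<phi> ` e) ` edges G)"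

definition copies :: "nat graph \<Rightarrow> nat \<Rightarrow> nat set set set" where
  "copies H n = {edges G | G. subgraph G (complete_graph n) \<and> graph_isomorphic H G}"


section \<open>Maximal matroids with prescribed circuits\<close>

definition H_matroid :: "nat graph \<Rightarrow> nat \<Rightarrow> (nat set set \<Rightarrow> bool) \<Rightarrow> bool" where
  "H_matroid H n M \<longleftrightarrow> matroid (edges (complete_graph n)) M \<and>
     (\<forall>X\<in>copies H n. is_circuit (edges (complete_graph n)) M X)"

definition maximal_H_matroid :: "nat graph \<Rightarrow> nat \<Rightarrow> (nat set set \<Rightarrow> bool) \<Rightarrow> bool" where
  "maximal_H_matroid H n M \<longleftrightarrow> H_matroid H n M \<and>
     (\<forall>M'. H_matroid H n M' \<and> weak_le M M' \<longrightarrow> M' = M)"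

definition unique_maximal_H_matroid :: "nat graph \<Rightarrow> nat \<Rightarrow> (nat set set \<Rightarrow> bool) \<Rightarrow> bool" where
  "unique_maximal_H_matroid H n M \<longleftrightarrow> maximal_H_matroid H n M \<and>
     (\<forall>M'. maximal_H_matroid H n M' \<longrightarrow> M' = M)"


section \<open>The count matroids\<close>

text \<open>The set of vertices incident to \<open>F\<close> is \<open>\<Union>F\<close>.\<close>

definition f_count :: "int \<Rightarrow> int \<Rightarrow> nat set set \<Rightarrow> int" where
  "f_count a b F = a * int (card (\<Union>F)) - b"

definition count_matroid :: "int \<Rightarrow> int \<Rightarrow> nat \<Rightarrow> nat set set \<Rightarrow> bool" where
  "count_matroid a b n F \<longleftrightarrow> F \<subseteq> edges (complete_graph n) \<and>
     (\<forall>I. I \<noteq> {} \<and> I \<subseteq> F \<longrightarrow> int (card I) \<le> f_count a b I)"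


section \<open>Proper sequences\<close>

text \<open>Sequences are lists, indexed from 0, so the condition for \<open>i \<ge> 2\<close> concerns the list indices
  \<open>1 \<le> i\<close>. The empty sequence is proper and has \<open>val F [] = |F|\<close>. The minimum below is over a
  finite set: the union of a proper sequence of edge sets in a finite graph grows at each step,
  which bounds the length.\<close>

definition proper_seq :: "'a set set \<Rightarrow> 'a set list \<Rightarrow> bool" where
  "proper_seq \<X> S \<longleftrightarrow> set S \<subseteq> \<X> \<and>
     (\<forall>i. 1 \<le> i \<and> i < length S \<longrightarrow> \<not> S ! i \<subseteq> (\<Union>j<i. S ! j))"

definition seq_val :: "'a set \<Rightarrow> 'a set list \<Rightarrow> int" where
  "seq_val F S = int (card (F \<union> \<Union>(set S))) - int (length S)"

definition val_H :: "nat graph \<Rightarrow> nat \<Rightarrow> nat set set \<Rightarrow> int" where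
  "val_H H n F = Min {seq_val F S | S. proper_seq (copies H n) S}"

definition rank_function_is :: "nat \<Rightarrow> (nat set set \<Rightarrow> bool) \<Rightarrow> (nat set set \<Rightarrow> int) \<Rightarrow> bool" where
  "rank_function_is n M r \<longleftrightarrow>
     (\<forall>F. F \<subseteq> edges (complete_graph n) \<longrightarrow> int (matroid_rank M F) = r F)"

end

theory Submission
  imports Defs
begin

text \<open>
  If a circuit \<open>X\<close> is not contained in \<open>F\<close>, then \<open>r(F \<union> X) < r(F) + |X - F|\<close> by submodularity of
  the rank \<open>r\<close>; hence \<open>r(F) \<le> val(F, S)\<close> in every \<open>H\<close>-matroid. Equality is reached by weak
  saturation: if every edge of \<open>F\<close> can be obtained from \<open>Z\<close> by adding edges one at a time, each
  completing a copy of \<open>H\<close>, then these copies form a proper sequence with \<open>val(F, S) \<le> |Z|\<close>. So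
  it suffices to find, for each \<open>F\<close>, such a set \<open>Z\<close> of at most \<open>r(F)\<close> edges, where \<open>r\<close> is the
  rank in the count matroid.

  Let \<open>B\<close> be a basis of \<open>F\<close>, and call a vertex set \<open>V\<close> tight if \<open>B\<close> has exactly \<open>a|V| - b\<close> edges
  inside \<open>V\<close>. Because \<open>b < 2a\<close>, two tight sets sharing an edge have a tight union, so the complete
  graphs on the maximal tight sets are edge-disjoint, and they cover \<open>F - B\<close>. In each of them we
  may therefore replace \<open>B\<close> by any at most \<open>a|V| - b\<close> edges that saturate to the complete graph on
  \<open>V\<close>. Such edges are found by starting with a complete graph on fewer than \<open>|V(H)|\<close> vertices, which
  is sparse, and adding the other vertices one at a time, joining each to \<open>a\<close> earlier ones: as \<open>H\<close>
  has a vertex of degree \<open>a + 1\<close>, each further edge at the new vertex completes a copy of \<open>H\<close>.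
\<close>

section \<open>Matroid rank\<close>

context matroid
begin

abbreviation rank :: "'a set \<Rightarrow> nat" where
  "rank \<equiv> matroid_rank indep"

lemma indep_finite: "indep I \<Longrightarrow> finite I"
  using carrier_finite indep_subset_carrier finite_subset by blast

lemma finite_indep_cards: "finite {card I | I. I \<subseteq> F \<and> indep I}"
  by (rule finite_subset[of _ "{..card carrier}"])
    (auto intro: card_mono carrier_finite dest: indep_subset_carrier)

lemma card_le_rank: "indep I \<Longrightarrow> I \<subseteq> F \<Longrightarrow> card I \<le> rank F"
  unfolding matroid_rank_def using finite_indep_cards by (intro Max_ge) auto

lemma obtain_basis_extending:
  assumes "indep I" "I \<subseteq> F"
  obtains B where "I \<subseteq> B" "B \<subseteq> F" "indep B" "card B = rank F"
proof -
  have "rank F \<in> {card J | J. J \<subseteq> F \<and> indep J}"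
    unfolding matroid_rank_def using assms finite_indep_cards by (intro Max_in) auto
  then obtain J where J: "J \<subseteq> F" "indep J" "card J = rank F"
    by auto
  let ?\<B> = "{B. B \<subseteq> F \<and> indep B}"
  have "finite ?\<B>"
    by (rule finite_subset[of _ "Pow carrier"]) (auto simp: carrier_finite dest: indep_subset_carrier)
  then obtain B where B: "I \<subseteq> B" "B \<subseteq> F" "indep B"
    and maximal: "\<And>B'. B' \<subseteq> F \<Longrightarrow> indep B' \<Longrightarrow> B \<subseteq> B' \<Longrightarrow> B = B'"
    using finite_has_maximal2[of ?\<B> I] assms by auto
  have "\<not> card B < card J"
  proof
    assume "card B < card J"
    then obtain x where "x \<in> J - B" "indep (insert x B)"
      using indep_augment J(2) B(3) by blast
    then show False
      using maximal[of "insert x B"] B(2) J(1) by blast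
  qed
  then have "card B = rank F"
    using card_le_rank[OF B(3,2)] J(3) by simp
  with B show ?thesis
    by (rule that)
qed

lemma rank_mono:
  assumes "F \<subseteq> G"
  shows "rank F \<le> rank G"
proof -
  obtain B where "B \<subseteq> F" "indep B" "card B = rank F"
    using obtain_basis_extending[OF indep_empty empty_subsetI] .
  then show ?thesis
    using assms card_le_rank[of B G] by auto
qed

lemma rank_le_card:
  assumes "finite F"
  shows "rank F \<le> card F"
proof -
  obtain B where "B \<subseteq> F" "card B = rank F"
    using obtain_basis_extending[OF indep_empty empty_subsetI] .
  then show ?thesis
    using assms card_mono[of F B] by simp
qed

lemma indep_iff_rank_eq_card:
  assumes "finite F"
  shows "indep F \<longleftrightarrow> rank F = card F"
proof
  show "rank F = card F" if "indep F"
    using card_le_rank[OF that subset_refl] rank_le_card[OF assms] by simp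
  assume "rank F = card F"
  moreover obtain B where "B \<subseteq> F" "indep B" "card B = rank F"
    using obtain_basis_extending[OF indep_empty empty_subsetI] .
  ultimately show "indep F"
    using assms card_subset_eq[of F B] by simp
qed

lemma rank_submodular: "rank (A \<union> B) + rank (A \<inter> B) \<le> rank A + rank B"
proof -
  obtain I where I: "I \<subseteq> A \<inter> B" "indep I" "card I = rank (A \<inter> B)"
    using obtain_basis_extending[OF indep_empty empty_subsetI] .
  obtain J where J: "I \<subseteq> J" "J \<subseteq> A \<union> B" "indep J" "card J = rank (A \<union> B)"
    using obtain_basis_extending[of I "A \<union> B"] I by blast
  have "card (J \<inter> A) \<le> rank A" "card (J \<inter> B) \<le> rank B"
    using indep_subset[OF J(3)] by (simp_all add: card_le_rank)
  moreover have "card (J \<inter> A) + card (J \<inter> B) = card (J \<inter> A \<union> J \<inter> B) + card (J \<inter> A \<inter> (J \<inter> B))"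
    using indep_finite[OF J(3)] by (intro card_Un_Int) auto
  moreover have "J \<inter> A \<union> J \<inter> B = J"
    using J(2) by auto
  moreover have "card I \<le> card (J \<inter> A \<inter> (J \<inter> B))"
    using I(1) J(1) indep_finite[OF J(3)] by (intro card_mono) auto
  ultimately show ?thesis
    using I(3) J(4) by simp
qed

lemma rank_Un_le:
  assumes "finite G"
  shows "rank (F \<union> G) \<le> rank F + card (G - F)"
  using rank_submodular[of F "G - F"] rank_le_card[of "G - F"] assms by simp

lemma rank_Un_circuit_less:
  assumes C: "is_circuit carrier indep C" and "\<not> C \<subseteq> F"
  shows "rank (F \<union> C) < rank F + card (C - F)"
proof -
  have finC: "finite C"
    using C carrier_finite finite_subset by (auto simp: is_circuit_def)
  have "rank C < card C"
    using C indep_iff_rank_eq_card[OF finC] rank_le_card[OF finC] by (simp add: is_circuit_def)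
  moreover have "indep (F \<inter> C)"
    using assms by (auto simp: is_circuit_def)
  then have "rank (F \<inter> C) = card (C \<inter> F)"
    using indep_iff_rank_eq_card[of "F \<inter> C"] finC by (simp add: Int_commute)
  ultimately show ?thesis
    using rank_submodular[of F C] card_Int_Diff[OF finC, of F] by linarith
qed

end

section \<open>Proper sequences and weak saturation\<close>

lemma proper_seq_Nil: "proper_seq \<X> []"
  by (simp add: proper_seq_def)

lemma proper_seq_snoc_iff:
  "proper_seq \<X> (S @ [X]) \<longleftrightarrow> proper_seq \<X> S \<and> X \<in> \<X> \<and> (S \<noteq> [] \<longrightarrow> \<not> X \<subseteq> \<Union>(set S))"
proof -
  define new where "new T i \<longleftrightarrow> \<not> T ! i \<subseteq> (\<Union>j<i. T ! j)" for T :: "'a set list" and i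
  have earlier: "new (S @ [X]) i = new S i" if "i < length S" for i
    using that by (simp add: new_def nth_append)
  have "\<Union>((!) (S @ [X]) ` {..<length S}) = \<Union>(set S)"
    by (auto simp: nth_append set_conv_nth)
  then have last: "new (S @ [X]) (length S) \<longleftrightarrow> \<not> X \<subseteq> \<Union>(set S)"
    by (simp add: new_def)
  have "proper_seq \<X> (S @ [X]) \<longleftrightarrow>
      set S \<subseteq> \<X> \<and> X \<in> \<X> \<and> (\<forall>i. 1 \<le> i \<and> i < Suc (length S) \<longrightarrow> new (S @ [X]) i)"
    by (auto simp: proper_seq_def new_def)
  also have "\<dots> \<longleftrightarrow> set S \<subseteq> \<X> \<and> X \<in> \<X> \<and> (\<forall>i. 1 \<le> i \<and> i < length S \<longrightarrow> new S i) \<and>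
      (S \<noteq> [] \<longrightarrow> \<not> X \<subseteq> \<Union>(set S))"
    by (auto simp: less_Suc_eq Suc_le_eq earlier last del: subsetI)
  finally show ?thesis
    by (auto simp: proper_seq_def new_def)
qed

lemma Union_proper_seq_subset:
  assumes "proper_seq \<X> S" "\<And>X. X \<in> \<X> \<Longrightarrow> X \<subseteq> E"
  shows "\<Union>(set S) \<subseteq> E"
  using assms unfolding proper_seq_def by blast

lemma card_Un_Diff:
  assumes "finite A" "finite B"
  shows "card (A \<union> B) = card A + card (B - A)"
  using card_Un_disjoint[of A "B - A"] assms by simp

context matroid
begin

lemma rank_Union_proper_seq:
  assumes "proper_seq \<X> S" and circuits: "\<And>X. X \<in> \<X> \<Longrightarrow> is_circuit carrier indep X"
  shows "rank (\<Union>(set S)) + length S \<le> card (\<Union>(set S))"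
  using assms(1)
proof (induction S rule: rev_induct)
  case Nil
  then show ?case
    using rank_le_card[of "{}"] by simp
next
  case (snoc X S)
  define U where "U = \<Union>(set S)"
  have S: "proper_seq \<X> S" "X \<in> \<X>" "S \<noteq> [] \<longrightarrow> \<not> X \<subseteq> U"
    using snoc.prems by (auto simp: proper_seq_snoc_iff U_def)
  have circuit: "is_circuit carrier indep X"
    using circuits S(2) .
  then have "X \<noteq> {}"
    using indep_empty by (auto simp: is_circuit_def)
  with S(3) have "\<not> X \<subseteq> U"
    by (cases "S = []") (auto simp: U_def)
  then have "rank (U \<union> X) < rank U + card (X - U)"
    by (rule rank_Un_circuit_less[OF circuit])
  moreover have "U \<subseteq> carrier" "X \<subseteq> carrier"
    using Union_proper_seq_subset[OF S(1)] circuit circuits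
    by (simp_all add: U_def is_circuit_def)
  then have "card (U \<union> X) = card U + card (X - U)"
    using carrier_finite by (intro card_Un_Diff) (auto intro: finite_subset)
  moreover have "rank U + length S \<le> card U"
    using snoc.IH[OF S(1)] by (simp add: U_def)
  ultimately show ?case
    by (simp add: U_def Un_commute)
qed

lemma rank_le_seq_val:
  assumes S: "proper_seq \<X> S" and circuits: "\<And>X. X \<in> \<X> \<Longrightarrow> is_circuit carrier indep X"
    and "F \<subseteq> carrier"
  shows "int (rank F) \<le> seq_val F S"
proof -
  let ?U = "\<Union>(set S)"
  have "?U \<subseteq> carrier"
    using Union_proper_seq_subset[OF S] circuits by (simp add: is_circuit_def)
  then have fin: "finite ?U" "finite F"
    using assms(3) carrier_finite by (auto intro: finite_subset)
  have "rank F \<le> rank (?U \<union> F)"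
    by (rule rank_mono) simp
  also have "\<dots> \<le> rank ?U + card (F - ?U)"
    by (rule rank_Un_le[OF fin(2)])
  finally show ?thesis
    using rank_Union_proper_seq[OF S circuits] card_Un_Diff[OF fin]
    by (simp add: seq_val_def Un_commute)
qed

end

inductive_set saturation :: "'a set set \<Rightarrow> 'a set \<Rightarrow> 'a set" for \<X> Z where
  base: "e \<in> Z \<Longrightarrow> e \<in> saturation \<X> Z"
| step: "X \<in> \<X> \<Longrightarrow> e \<in> X \<Longrightarrow> (\<And>x. x \<in> X \<Longrightarrow> x \<noteq> e \<Longrightarrow> x \<in> saturation \<X> Z) \<Longrightarrow> e \<in> saturation \<X> Z"

lemma saturation_mono:
  assumes "Z \<subseteq> Z'"
  shows "saturation \<X> Z \<subseteq> saturation \<X> Z'"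
proof
  show "e \<in> saturation \<X> Z'" if "e \<in> saturation \<X> Z" for e
    using that assms by induction (auto intro: saturation.intros)
qed

lemma saturation_least:
  assumes "Z \<subseteq> W" and closed: "\<And>X e. X \<in> \<X> \<Longrightarrow> e \<in> X \<Longrightarrow> X - {e} \<subseteq> W \<Longrightarrow> e \<in> W"
  shows "saturation \<X> Z \<subseteq> W"
proof
  show "e \<in> W" if "e \<in> saturation \<X> Z" for e
    using that
  proof induction
    case (base e)
    then show ?case using assms(1) by auto
  next
    case (step X e)
    then show ?case by (intro closed[of X]) auto
  qed
qed

lemma saturation_eq_Un_proper_seq:
  assumes "finite (saturation \<X> Z)"
  shows "\<exists>S. proper_seq \<X> S \<and> saturation \<X> Z = Z \<union> \<Union>(set S) \<and>
    card (saturation \<X> Z) = card Z + length S"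
proof -
  define gen where "gen W \<longleftrightarrow> W \<subseteq> saturation \<X> Z \<and>
    (\<exists>S. proper_seq \<X> S \<and> W = Z \<union> \<Union>(set S) \<and> card W = card Z + length S)" for W
  have "gen Z"
    by (auto simp: gen_def intro: saturation.base proper_seq_Nil exI[of _ "[]"])
  moreover have "finite {W. gen W}"
    by (rule finite_subset[of _ "Pow (saturation \<X> Z)"]) (auto simp: gen_def assms)
  ultimately obtain W where W: "gen W" "Z \<subseteq> W" and maximal: "\<And>W'. gen W' \<Longrightarrow> W \<subseteq> W' \<Longrightarrow> W = W'"
    using finite_has_maximal2[of "{W. gen W}" Z] by auto
  then obtain S where S: "W \<subseteq> saturation \<X> Z" "proper_seq \<X> S" "W = Z \<union> \<Union>(set S)"
    "card W = card Z + length S"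
    by (auto simp: gen_def)
  have "saturation \<X> Z \<subseteq> W"
  proof (rule saturation_least[OF W(2)], rule ccontr)
    fix X e assume X: "X \<in> \<X>" "e \<in> X" "X - {e} \<subseteq> W" and "e \<notin> W"
    have "e \<in> saturation \<X> Z"
      using X S(1) by (auto intro: saturation.step)
    moreover have "proper_seq \<X> (S @ [X])"
      using S X \<open>e \<notin> W\<close> by (auto simp: proper_seq_snoc_iff)
    moreover have "insert e W = Z \<union> \<Union>(set (S @ [X]))"
      using S(3) X by auto
    moreover have "card (insert e W) = card Z + length (S @ [X])"
      using S(4) \<open>e \<notin> W\<close> finite_subset[OF S(1) assms] by simp
    ultimately have "gen (insert e W)"
      unfolding gen_def using S(1) by blast
    with maximal[of "insert e W"] \<open>e \<notin> W\<close> show False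
      by blast
  qed
  with S(1) have "W = saturation \<X> Z"
    by (rule subset_antisym)
  with S(2-4) show ?thesis
    by (intro exI[of _ S]) simp
qed

lemma exists_proper_seq_seq_val_le:
  assumes "finite (saturation \<X> Z)" "F \<subseteq> saturation \<X> Z"
  shows "\<exists>S. proper_seq \<X> S \<and> seq_val F S \<le> int (card Z)"
proof -
  obtain S where S: "proper_seq \<X> S" "saturation \<X> Z = Z \<union> \<Union>(set S)"
    "card (saturation \<X> Z) = card Z + length S"
    using saturation_eq_Un_proper_seq[OF assms(1)] by auto
  have "card (F \<union> \<Union>(set S)) \<le> card (saturation \<X> Z)"
    using assms S(2) by (intro card_mono) auto
  with S(1,3) show ?thesis
    by (auto simp: seq_val_def intro!: exI[of _ S])
qed

section \<open>A criterion for unique maximality\<close>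

lemma H_matroid_rank_le_seq_val:
  assumes "H_matroid H n M" "proper_seq (copies H n) S" "F \<subseteq> edges (complete_graph n)"
  shows "int (matroid_rank M F) \<le> seq_val F S"
  using assms by (intro matroid.rank_le_seq_val) (auto simp: H_matroid_def)

lemma unique_maximal_H_matroid_if_rank_attained:
  assumes M: "H_matroid H n M"
    and attained: "\<And>F. F \<subseteq> edges (complete_graph n) \<Longrightarrow>
      \<exists>S. proper_seq (copies H n) S \<and> seq_val F S \<le> int (matroid_rank M F)"
  shows "unique_maximal_H_matroid H n M"
proof -
  have above: "weak_le M' M" if M': "H_matroid H n M'" for M'
    unfolding weak_le_def
  proof (intro allI impI)
    fix F assume F: "M' F"
    interpret M: matroid "edges (complete_graph n)" M
      using M by (simp add: H_matroid_def)
    interpret M': matroid "edges (complete_graph n)" M'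
      using M' by (simp add: H_matroid_def)
    note FE = M'.indep_subset_carrier[OF F] and finF = M'.indep_finite[OF F]
    obtain S where S: "proper_seq (copies H n) S" "seq_val F S \<le> int (M.rank F)"
      using attained[OF FE] by auto
    have "card F = M'.rank F"
      using F M'.indep_iff_rank_eq_card[OF finF] by simp
    also have "int (M'.rank F) \<le> int (M.rank F)"
      using H_matroid_rank_le_seq_val[OF M' S(1) FE] S(2) by simp
    finally show "M F"
      using M.rank_le_card[OF finF] M.indep_iff_rank_eq_card[OF finF] by simp
  qed
  then have "maximal_H_matroid H n M"
    using M by (auto simp: maximal_H_matroid_def weak_le_def fun_eq_iff)
  moreover have "M' = M" if "maximal_H_matroid H n M'" for M'
    using that M above by (auto simp: maximal_H_matroid_def)
  ultimately show ?thesis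
    unfolding unique_maximal_H_matroid_def by blast
qed

lemma rank_function_is_val_H_if_rank_attained:
  assumes M: "H_matroid H n M"
    and attained: "\<And>F. F \<subseteq> edges (complete_graph n) \<Longrightarrow>
      \<exists>S. proper_seq (copies H n) S \<and> seq_val F S \<le> int (matroid_rank M F)"
  shows "rank_function_is n M (val_H H n)"
  unfolding rank_function_is_def
proof (intro allI impI)
  let ?E = "edges (complete_graph n)"
  fix F assume F: "F \<subseteq> ?E"
  let ?vals = "{seq_val F S | S. proper_seq (copies H n) S}"
  have finE: "finite ?E"
    using M by (auto simp: H_matroid_def intro: matroid.carrier_finite)
  have lower: "int (matroid_rank M F) \<le> seq_val F S" if "proper_seq (copies H n) S" for S
    using H_matroid_rank_le_seq_val[OF M that F] .
  have upper: "seq_val F S \<le> int (card ?E)" if "proper_seq (copies H n) S" for S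
  proof -
    have "\<Union>(set S) \<subseteq> ?E"
      using Union_proper_seq_subset[OF that] M by (simp add: H_matroid_def is_circuit_def)
    then have "card (F \<union> \<Union>(set S)) \<le> card ?E"
      using F finE by (intro card_mono) auto
    then show ?thesis
      by (simp add: seq_val_def)
  qed
  obtain S where S: "proper_seq (copies H n) S" "seq_val F S \<le> int (matroid_rank M F)"
    using attained[OF F] by auto
  have "Min ?vals = int (matroid_rank M F)"
  proof (rule Min_eqI)
    show "finite ?vals"
      by (rule finite_subset[of _ "{int (matroid_rank M F)..int (card ?E)}"])
        (auto simp: lower upper)
    show "int (matroid_rank M F) \<le> y" if "y \<in> ?vals" for y
      using that lower by auto
    have "int (matroid_rank M F) = seq_val F S"
      using S(2) lower[OF S(1)] by simp
    with S(1) show "int (matroid_rank M F) \<in> ?vals"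
      by blast
  qed
  then show "int (matroid_rank M F) = val_H H n F"
    by (simp add: val_H_def)
qed

section \<open>Complete graphs and copies\<close>

definition all_edges :: "'v set \<Rightarrow> 'v set set" where
  "all_edges V = {e. e \<subseteq> V \<and> card e = 2}"

definition star :: "'v \<Rightarrow> 'v set \<Rightarrow> 'v set set" where
  "star v T = (\<lambda>w. {v, w}) ` T"

definition neighbors :: "'v graph \<Rightarrow> 'v \<Rightarrow> 'v set" where
  "neighbors G v = {w. {v, w} \<in> edges G}"

lemma verts_Pair [simp]: "verts (V, E) = V"
  by (simp add: verts_def)

lemma edges_Pair [simp]: "edges (V, E) = E"
  by (simp add: edges_def)

lemma verts_complete_graph [simp]: "verts (complete_graph n) = {..<n}"
  by (simp add: complete_graph_def)

lemma edges_complete_graph [simp]: "edges (complete_graph n) = all_edges {..<n}"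
  by (auto simp: complete_graph_def all_edges_def card_2_iff)

lemma image_star: "(`) \<phi> ` star v T = star (\<phi> v) (\<phi> ` T)"
  by (simp add: star_def image_image)

lemma finite_all_edges: "finite V \<Longrightarrow> finite (all_edges V)"
  by (simp add: all_edges_def)

lemma card_all_edges: "finite V \<Longrightarrow> card (all_edges V) = card V choose 2"
  by (simp add: all_edges_def n_subsets)

lemma all_edges_mono: "V \<subseteq> W \<Longrightarrow> all_edges V \<subseteq> all_edges W"
  by (auto simp: all_edges_def)

lemma doubleton_in_all_edges_iff: "{v, w} \<in> all_edges V \<longleftrightarrow> v \<in> V \<and> w \<in> V \<and> v \<noteq> w"
  by (auto simp: all_edges_def card_insert_if)

lemma two_le_card_if_edge: "e \<in> all_edges V \<Longrightarrow> finite V \<Longrightarrow> 2 \<le> card V"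
  using card_mono[of V e] by (simp add: all_edges_def)

lemma all_edges_Int: "all_edges (V \<inter> W) = all_edges V \<inter> all_edges W"
  by (auto simp: all_edges_def)

lemma all_edges_insert:
  assumes "v \<notin> V"
  shows "all_edges (insert v V) = all_edges V \<union> star v V"
proof
  show "all_edges (insert v V) \<subseteq> all_edges V \<union> star v V"
  proof
    fix e assume e: "e \<in> all_edges (insert v V)"
    then obtain x y where xy: "e = {x, y}" "x \<noteq> y"
      by (auto simp: all_edges_def card_2_iff)
    with e show "e \<in> all_edges V \<union> star v V"
      by (auto simp: all_edges_def star_def)
  qed
  show "all_edges V \<union> star v V \<subseteq> all_edges (insert v V)"
    using assms by (auto simp: all_edges_def star_def card_2_iff)
qed

lemma image_all_edges_subset:
  assumes "inj_on \<phi> V"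
  shows "(`) \<phi> ` all_edges V \<subseteq> all_edges (\<phi> ` V)"
  using assms by (auto simp: all_edges_def card_image inj_on_subset)

lemma simple_graph_iff: "simple_graph G \<longleftrightarrow> edges G \<subseteq> all_edges (verts G)"
  by (auto simp: simple_graph_def all_edges_def)

lemma neighbors_subset:
  assumes "simple_graph G"
  shows "neighbors G v \<subseteq> verts G - {v}"
  using assms by (auto simp: simple_graph_def neighbors_def)

lemma edges_eq_Un_star:
  assumes "simple_graph G"
  shows "edges G = {e \<in> edges G. v \<notin> e} \<union> star v (neighbors G v)"
proof -
  have "e \<in> star v (neighbors G v)" if e: "e \<in> edges G" "v \<in> e" for e
  proof -
    have "card e = 2"
      using assms e(1) by (simp add: simple_graph_def)
    then obtain w where "e = {v, w}"
      using e(2) by (auto simp: card_2_iff)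
    with e(1) show ?thesis
      by (auto simp: star_def neighbors_def)
  qed
  then show ?thesis
    by (auto simp: star_def neighbors_def)
qed

lemma copies_eq_embeddings:
  assumes simple: "simple_graph H"
  shows "copies H n = {(`) \<phi> ` edges H | \<phi>. inj_on \<phi> (verts H) \<and> \<phi> ` verts H \<subseteq> {..<n}}"
    (is "_ = ?embeddings")
proof (intro equalityI subsetI)
  fix X assume "X \<in> copies H n"
  then show "X \<in> ?embeddings"
    by (auto simp: copies_def subgraph_def graph_isomorphic_def bij_betw_def)
next
  fix X assume "X \<in> ?embeddings"
  then obtain \<phi> where X: "X = (`) \<phi> ` edges H"
    and \<phi>: "inj_on \<phi> (verts H)" "\<phi> ` verts H \<subseteq> {..<n}"
    by auto
  have "X \<subseteq> all_edges (\<phi> ` verts H)"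
    using X simple image_all_edges_subset[OF \<phi>(1)] by (auto simp: simple_graph_iff)
  then have "subgraph (\<phi> ` verts H, X) (complete_graph n)"
    using \<phi>(2) all_edges_mono[OF \<phi>(2)] by (auto simp: subgraph_def simple_graph_iff)
  moreover have "graph_isomorphic H (\<phi> ` verts H, X)"
    using X inj_on_imp_bij_betw[OF \<phi>(1)] by (auto simp: graph_isomorphic_def)
  ultimately show "X \<in> copies H n"
    unfolding copies_def by force
qed

lemma copy_obtain_verts:
  assumes simple: "simple_graph H" and "X \<in> copies H n"
  obtains V where "V \<subseteq> {..<n}" "card V = card (verts H)" "X \<subseteq> all_edges V"
    "card X = card (edges H)"
proof -
  obtain \<phi> where X: "X = (`) \<phi> ` edges H"
    and \<phi>: "inj_on \<phi> (verts H)" "\<phi> ` verts H \<subseteq> {..<n}"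
    using assms by (auto simp: copies_eq_embeddings)
  show ?thesis
  proof
    show "\<phi> ` verts H \<subseteq> {..<n}" "card (\<phi> ` verts H) = card (verts H)"
      using \<phi> by (simp_all add: card_image)
    show "X \<subseteq> all_edges (\<phi> ` verts H)"
      using X simple image_all_edges_subset[OF \<phi>(1)] by (auto simp: simple_graph_iff)
    have "inj_on ((`) \<phi>) (edges H)"
      using simple inj_on_image_Pow[OF \<phi>(1)] by (auto simp: simple_graph_def intro: inj_on_subset)
    then show "card X = card (edges H)"
      using X by (simp add: card_image)
  qed
qed

lemma exists_inj_on_image_eq:
  assumes "finite A" "finite B" "card A \<le> card B" "C \<subseteq> A" "D \<subseteq> B" "card C = card D"
  shows "\<exists>f. inj_on f A \<and> f ` A \<subseteq> B \<and> f ` C = D"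
proof -
  have fin: "finite C" "finite D"
    using assms finite_subset by auto
  obtain g where g: "bij_betw g C D"
    using finite_same_card_bij[OF fin assms(6)] by auto
  have "card (A - C) \<le> card (B - D)"
    using assms fin by (simp add: card_Diff_subset)
  then obtain h where h: "h ` (A - C) \<subseteq> B - D" "inj_on h (A - C)"
    using card_le_inj[of "A - C" "B - D"] assms by auto
  define f where "f x = (if x \<in> C then g x else h x)" for x
  have A: "A = C \<union> (A - C)"
    using assms(4) by auto
  have "inj_on f (C \<union> (A - C))"
    unfolding f_def using g h by (intro inj_on_disjoint_Un) (auto simp: bij_betw_def)
  moreover have "f ` C = D" "f ` (A - C) \<subseteq> B - D"
    using g h(1) by (auto simp: f_def bij_betw_def)
  then have "f ` (C \<union> (A - C)) \<subseteq> B" "f ` C = D"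
    using assms(5) by auto
  ultimately show ?thesis
    using A by metis
qed

lemma exists_embedding_at_vertex:
  assumes simple: "simple_graph H" and fin: "finite (verts H)" "finite V" and "x \<in> verts H"
    and card_V: "card (verts H) \<le> Suc (card V)" and "v \<notin> V"
    and T: "T \<subseteq> V" "card T = card (neighbors H x)"
  shows "\<exists>\<phi>. inj_on \<phi> (verts H) \<and> \<phi> x = v \<and> \<phi> ` (verts H - {x}) \<subseteq> V \<and> \<phi> ` neighbors H x = T"
proof -
  define A where "A = verts H - {x}"
  have A: "verts H = insert x A" "x \<notin> A" "finite A" "neighbors H x \<subseteq> A"
    using assms neighbors_subset[OF simple] by (auto simp: A_def)
  then have "card A \<le> card V"
    using card_V by simp
  then obtain f where f: "inj_on f A" "f ` A \<subseteq> V" "f ` neighbors H x = T"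
    using exists_inj_on_image_eq[OF A(3) fin(2) _ A(4) T(1)] T(2) by auto
  define \<phi> where "\<phi> = f(x := v)"
  have \<phi>_eq_f: "\<phi> ` B = f ` B" if "B \<subseteq> A" for B
    using that A(2) by (intro image_cong) (auto simp: \<phi>_def)
  have "inj_on \<phi> (verts H)"
    unfolding A(1) \<phi>_def using f(1,2) A(2) \<open>v \<notin> V\<close> by (auto simp: inj_on_def)
  moreover have "\<phi> x = v"
    by (simp add: \<phi>_def)
  ultimately show ?thesis
    using f(2,3) by (intro exI[of _ \<phi>]) (simp add: A_def[symmetric] \<phi>_eq_f A(4))
qed

lemma exists_copy_at_new_vertex:
  assumes simple: "simple_graph H" and "finite (verts H)" and x: "x \<in> verts H"
    and V: "V \<subseteq> {..<n}" "card (verts H) \<le> Suc (card V)" and v: "v \<in> {..<n} - V"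
    and T: "T \<subseteq> V" "card T = card (neighbors H x)"
  shows "\<exists>X\<in>copies H n. star v T \<subseteq> X \<and> X \<subseteq> all_edges V \<union> star v T"
proof -
  have "finite V"
    using V(1) finite_subset by auto
  then obtain \<phi> where \<phi>: "inj_on \<phi> (verts H)" "\<phi> x = v" "\<phi> ` (verts H - {x}) \<subseteq> V"
    "\<phi> ` neighbors H x = T"
    using exists_embedding_at_vertex[OF simple _ _ x V(2) _ T] assms(2) v by blast
  have "\<phi> ` verts H \<subseteq> {..<n}"
    using \<phi>(2,3) V(1) v by auto
  then have copy: "(`) \<phi> ` edges H \<in> copies H n"
    using simple \<phi>(1) by (auto simp: copies_eq_embeddings)
  have image: "(`) \<phi> ` edges H = (`) \<phi> ` {e \<in> edges H. x \<notin> e} \<union> star v T"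
    by (subst edges_eq_Un_star[OF simple, of x]) (simp only: image_Un image_star \<phi>)
  have "{e \<in> edges H. x \<notin> e} \<subseteq> all_edges (verts H - {x})"
    using simple by (auto simp: simple_graph_def all_edges_def)
  then have "(`) \<phi> ` {e \<in> edges H. x \<notin> e} \<subseteq> all_edges V"
    using image_all_edges_subset[OF inj_on_subset[OF \<phi>(1)], of "verts H - {x}"]
      all_edges_mono[OF \<phi>(3)] by blast
  then show ?thesis
    by (intro bexI[OF _ copy]) (auto simp: image)
qed

section \<open>Count matroids\<close>

locale count_params =
  fixes a b :: int and n :: nat
  assumes a_nonneg: "0 \<le> a" and b_less: "b < 2 * a"
begin

abbreviation sparse :: "nat set set \<Rightarrow> bool" where
  "sparse \<equiv> count_matroid a b n"

definition tight :: "nat set set \<Rightarrow> nat set \<Rightarrow> bool" where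
  "tight Y V \<longleftrightarrow> V \<subseteq> {..<n} \<and> 2 \<le> card V \<and>
     int (card (Y \<inter> all_edges V)) = a * int (card V) - b"

definition blocks :: "nat set set \<Rightarrow> nat set set" where
  "blocks Y = {V. tight Y V \<and> (\<forall>W. tight Y W \<and> V \<subseteq> W \<longrightarrow> W = V)}"

definition block_edges :: "nat set set \<Rightarrow> nat set set" where
  "block_edges Y = \<Union>(all_edges ` blocks Y)"

lemma bound_mono: "k \<le> l \<Longrightarrow> a * int k - b \<le> a * int l - b"
  using a_nonneg by (simp add: mult_left_mono)

lemma bound_pos: "2 \<le> k \<Longrightarrow> 0 < a * int k - b"
  using bound_mono[of 2 k] b_less by simp

lemma sparse_iff:
  "sparse Y \<longleftrightarrow> Y \<subseteq> all_edges {..<n} \<and>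
    (\<forall>I. I \<noteq> {} \<and> I \<subseteq> Y \<longrightarrow> int (card I) \<le> a * int (card (\<Union>I)) - b)"
  by (simp add: count_matroid_def f_count_def)

lemma sparse_subset_all_edges: "sparse Y \<Longrightarrow> Y \<subseteq> all_edges {..<n}"
  by (simp add: sparse_iff)

lemma sparse_finite: "sparse Y \<Longrightarrow> finite Y"
  by (rule finite_subset[OF sparse_subset_all_edges]) (simp_all add: finite_all_edges)

lemma sparse_card_Int_le:
  assumes "sparse Y" "finite V" "2 \<le> card V"
  shows "int (card (Y \<inter> all_edges V)) \<le> a * int (card V) - b"
proof (cases "Y \<inter> all_edges V = {}")
  case True
  then show ?thesis
    using bound_pos[OF assms(3)] by simp
next
  case False
  then have "int (card (Y \<inter> all_edges V)) \<le> a * int (card (\<Union>(Y \<inter> all_edges V))) - b"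
    using assms(1) by (auto simp: sparse_iff)
  also have "\<dots> \<le> a * int (card V) - b"
    using assms(2) by (intro bound_mono card_mono) (auto simp: all_edges_def)
  finally show ?thesis .
qed

lemma tight_finite: "tight Y V \<Longrightarrow> finite V"
  by (auto simp: tight_def intro: finite_subset)

lemma tight_Un:
  assumes Y: "sparse Y" and V: "tight Y V" and W: "tight Y W" and two_le_Int: "2 \<le> card (V \<inter> W)"
  shows "tight Y (V \<union> W)"
proof -
  let ?i = "\<lambda>V. card (Y \<inter> all_edges V)"
  note finY = sparse_finite[OF Y] and fin = tight_finite[OF V] tight_finite[OF W]
  have two_le_Un: "2 \<le> card (V \<union> W)"
    using V fin card_mono[of "V \<union> W" V] by (auto simp: tight_def)
  have "?i V + ?i W = card (Y \<inter> all_edges V \<union> Y \<inter> all_edges W) + ?i (V \<inter> W)"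
    using finY card_Un_Int[of "Y \<inter> all_edges V" "Y \<inter> all_edges W"]
    by (simp add: all_edges_Int Int_ac)
  also have "card (Y \<inter> all_edges V \<union> Y \<inter> all_edges W) \<le> ?i (V \<union> W)"
    using finY by (intro card_mono) (auto simp: all_edges_def)
  finally have "?i V + ?i W \<le> ?i (V \<union> W) + ?i (V \<inter> W)"
    by simp
  moreover have "int (?i (V \<inter> W)) \<le> a * int (card (V \<inter> W)) - b"
    using sparse_card_Int_le[OF Y _ two_le_Int] fin by simp
  moreover have "int (?i (V \<union> W)) \<le> a * int (card (V \<union> W)) - b"
    using sparse_card_Int_le[OF Y _ two_le_Un] fin by simp
  moreover have "a * int (card V) + a * int (card W) =
      a * int (card (V \<union> W)) + a * int (card (V \<inter> W))"
    using card_Un_Int[OF fin] by (metis distrib_left of_nat_add)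
  ultimately have "int (?i (V \<union> W)) = a * int (card (V \<union> W)) - b"
    using V W by (auto simp: tight_def)
  then show ?thesis
    using V W two_le_Un by (auto simp: tight_def)
qed

lemma finite_tight: "finite {V. tight Y V}"
  by (rule finite_subset[of _ "Pow {..<n}"]) (auto simp: tight_def)

lemma blocks_tight: "V \<in> blocks Y \<Longrightarrow> tight Y V"
  by (simp add: blocks_def)

lemma finite_blocks: "finite (blocks Y)"
  by (rule finite_subset[OF _ finite_tight[of Y]]) (auto simp: blocks_def)

lemma blocks_disjoint:
  assumes "sparse Y" "V \<in> blocks Y" "W \<in> blocks Y" "V \<noteq> W"
  shows "all_edges V \<inter> all_edges W = {}"
proof (rule ccontr)
  assume "all_edges V \<inter> all_edges W \<noteq> {}"
  then obtain e where "e \<in> all_edges (V \<inter> W)"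
    by (auto simp: all_edges_Int)
  then have "2 \<le> card (V \<inter> W)"
    using tight_finite[OF blocks_tight[OF assms(2)]] by (intro two_le_card_if_edge) auto
  then have "tight Y (V \<union> W)"
    using tight_Un assms blocks_tight by blast
  then have "V \<union> W = V" "V \<union> W = W"
    using assms(2,3) by (auto simp: blocks_def)
  with assms(4) show False
    by auto
qed

lemma dependent_edge_in_block_edges:
  assumes Y: "sparse Y" and e: "e \<in> all_edges {..<n}" and dependent: "\<not> sparse (insert e Y)"
  shows "e \<in> block_edges Y"
proof -
  have "insert e Y \<subseteq> all_edges {..<n}"
    using sparse_subset_all_edges[OF Y] e by simp
  then obtain I where I: "I \<noteq> {}" "I \<subseteq> insert e Y" "a * int (card (\<Union>I)) - b < int (card I)"
    using dependent unfolding sparse_iff by (meson not_le)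
  have "\<not> I \<subseteq> Y"
    using I(1,3) Y unfolding sparse_iff by (meson not_le)
  with I(2) have "e \<in> I"
    by auto
  define V where "V = \<Union>I"
  have I_edges: "I \<subseteq> all_edges V" and V_subset: "V \<subseteq> {..<n}"
    using I(2) \<open>insert e Y \<subseteq> _\<close> by (fastforce simp: V_def all_edges_def)+
  then have eV: "e \<in> all_edges V" and finV: "finite V"
    using \<open>e \<in> I\<close> by (auto intro: finite_subset)
  then have two_le_card_V: "2 \<le> card V"
    by (rule two_le_card_if_edge)
  have "finite I"
    using I(2) sparse_finite[OF Y] by (auto intro: finite_subset)
  then have "card I = Suc (card (I - {e}))"
    using card_Suc_Diff1[of I e] \<open>e \<in> I\<close> by simp
  also have "card (I - {e}) \<le> card (Y \<inter> all_edges V)"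
    using I(2) I_edges sparse_finite[OF Y] by (intro card_mono) auto
  finally have "a * int (card V) - b \<le> int (card (Y \<inter> all_edges V))"
    using I(3) by (simp add: V_def)
  then have "tight Y V"
    using sparse_card_Int_le[OF Y finV two_le_card_V] V_subset two_le_card_V by (simp add: tight_def)
  then obtain W where "V \<subseteq> W" "tight Y W" "\<And>W'. tight Y W' \<Longrightarrow> W \<subseteq> W' \<Longrightarrow> W' = W"
    using finite_has_maximal2[OF finite_tight, of V Y] by auto
  then have "W \<in> blocks Y" "e \<in> all_edges W"
    using eV all_edges_mono[of V W] by (auto simp: blocks_def)
  then show ?thesis
    by (auto simp: block_edges_def)
qed

lemma card_UN_blocks_le:
  assumes Y: "sparse Y"
    and card_Z: "\<And>V. V \<in> blocks Y \<Longrightarrow> int (card (Z V)) \<le> a * int (card V) - b"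
  shows "card (\<Union>V\<in>blocks Y. Z V) \<le> card (Y \<inter> block_edges Y)"
proof -
  have "card (\<Union>V\<in>blocks Y. Z V) \<le> (\<Sum>V\<in>blocks Y. card (Z V))"
    by (rule card_UN_le[OF finite_blocks])
  also have "\<dots> \<le> (\<Sum>V\<in>blocks Y. card (Y \<inter> all_edges V))"
    using card_Z blocks_tight by (intro sum_mono) (fastforce simp: tight_def)
  also have "\<dots> = card (\<Union>V\<in>blocks Y. Y \<inter> all_edges V)"
    using sparse_finite[OF Y] blocks_disjoint[OF Y]
    by (intro card_UN_disjoint[symmetric] finite_blocks) auto
  also have "(\<Union>V\<in>blocks Y. Y \<inter> all_edges V) = Y \<inter> block_edges Y"
    by (auto simp: block_edges_def)
  finally show ?thesis .
qed

lemma sparse_card_le_if_covered: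
  assumes X: "sparse X" and Y: "sparse Y" and "X - Y \<subseteq> block_edges Y"
  shows "card X \<le> card Y"
proof -
  let ?U = "block_edges Y"
  note fin = sparse_finite[OF X] sparse_finite[OF Y]
  have "card (\<Union>V\<in>blocks Y. X \<inter> all_edges V) \<le> card (Y \<inter> ?U)"
  proof (rule card_UN_blocks_le[OF Y])
    show "int (card (X \<inter> all_edges V)) \<le> a * int (card V) - b" if "V \<in> blocks Y" for V
      using sparse_card_Int_le[OF X tight_finite] blocks_tight[OF that]
      unfolding tight_def by blast
  qed
  then have "card (X \<inter> ?U) \<le> card (Y \<inter> ?U)"
    by (simp add: block_edges_def)
  moreover have "card (X - ?U) \<le> card (Y - ?U)"
    using assms(3) fin by (intro card_mono) auto
  ultimately show ?thesis
    using card_Int_Diff[OF fin(1), of ?U] card_Int_Diff[OF fin(2), of ?U] by linarith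
qed

lemma matroid_sparse: "matroid (edges (complete_graph n)) sparse"
proof
  show "finite (edges (complete_graph n))"
    by (simp add: finite_all_edges)
  show "X \<subseteq> edges (complete_graph n)" if "sparse X" for X
    using sparse_subset_all_edges[OF that] by simp
  show "sparse {}"
    by (simp add: sparse_iff)
  show "sparse Y" if "sparse X" "Y \<subseteq> X" for X Y
    using that unfolding sparse_iff by blast
  fix X Y assume XY: "sparse X" "sparse Y" "card Y < card X"
  then have "\<not> X - Y \<subseteq> block_edges Y"
    using sparse_card_le_if_covered by fastforce
  then obtain e where e: "e \<in> X - Y" "e \<notin> block_edges Y"
    by auto
  then have "sparse (insert e Y)"
    using dependent_edge_in_block_edges[OF XY(2)] sparse_subset_all_edges[OF XY(1)] by blast
  with e show "\<exists>x\<in>X - Y. sparse (insert x Y)"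
    by blast
qed

lemma sparse_if_psubset:
  assumes "finite V" and X: "X \<subseteq> all_edges V" "X \<subseteq> all_edges {..<n}"
    and card_X: "int (card X) = a * int (card V) - b + 1"
    and small: "\<And>j. 2 \<le> j \<Longrightarrow> j < card V \<Longrightarrow> int (j choose 2) \<le> a * int j - b"
    and "D \<subset> X"
  shows "sparse D"
  unfolding sparse_iff
proof (intro conjI allI impI)
  show "D \<subseteq> all_edges {..<n}"
    using \<open>D \<subset> X\<close> X(2) by auto
  fix I assume "I \<noteq> {} \<and> I \<subseteq> D"
  then have I: "I \<noteq> {}" "I \<subset> X"
    using \<open>D \<subset> X\<close> by auto
  have I_edges: "I \<subseteq> all_edges (\<Union>I)" and "\<Union>I \<subseteq> V"
    using I(2) X(1) by (auto simp: all_edges_def)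
  then have fin: "finite (\<Union>I)" and le: "card (\<Union>I) \<le> card V"
    using \<open>finite V\<close> by (auto intro: finite_subset card_mono)
  show "int (card I) \<le> a * int (card (\<Union>I)) - b"
  proof (cases "card (\<Union>I) = card V")
    case True
    have "card I < card X"
      using I(2) X(1) \<open>finite V\<close> by (meson finite_all_edges finite_subset psubset_card_mono)
    with card_X True show ?thesis
      by simp
  next
    case False
    have "card I \<le> card (\<Union>I) choose 2"
      using card_mono[OF finite_all_edges[OF fin] I_edges] by (simp add: card_all_edges[OF fin])
    moreover have "2 \<le> card (\<Union>I)"
      using I(1) I_edges fin two_le_card_if_edge by blast
    ultimately show ?thesis
      using small[of "card (\<Union>I)"] le False by linarith
  qed
qed

lemma is_circuit_sparse:
  assumes V: "V \<subseteq> {..<n}" "2 \<le> card V" and X: "X \<subseteq> all_edges V"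
    and card_X: "int (card X) = a * int (card V) - b + 1"
    and small: "\<And>j. 2 \<le> j \<Longrightarrow> j < card V \<Longrightarrow> int (j choose 2) \<le> a * int j - b"
  shows "is_circuit (edges (complete_graph n)) sparse X"
proof -
  have finV: "finite V"
    using V(1) finite_subset by auto
  have X_edges: "X \<subseteq> all_edges {..<n}"
    using X all_edges_mono[OF V(1)] by auto
  have "\<not> sparse X"
    using sparse_card_Int_le[of X V] finV V(2) X card_X by (auto simp: Int_absorb2)
  moreover have "sparse D" if "D \<subset> X" for D
    using finV X X_edges card_X small that by (rule sparse_if_psubset)
  ultimately show ?thesis
    using X_edges by (auto simp: is_circuit_def)
qed

lemma basis_diff_subset_block_edges:
  assumes "F \<subseteq> all_edges {..<n}" and B: "B \<subseteq> F" "sparse B" "card B = matroid_rank sparse F"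
  shows "F - B \<subseteq> block_edges B"
proof
  fix e assume e: "e \<in> F - B"
  have "\<not> sparse (insert e B)"
  proof
    assume "sparse (insert e B)"
    then have "card (insert e B) \<le> matroid_rank sparse F"
      using e B(1) by (intro matroid.card_le_rank[OF matroid_sparse]) auto
    then show False
      using e B(3) sparse_finite[OF B(2)] by simp
  qed
  then show "e \<in> block_edges B"
    using dependent_edge_in_block_edges[OF B(2)] e assms(1) by auto
qed

end

section \<open>Count matroids generated by copies of a graph\<close>

locale count_generating_graph =
  fixes a b :: int and H :: "nat graph" and x :: nat
  assumes a_nonneg: "0 \<le> a"
    and simple_H: "simple_graph H"
    and card_verts: "2 < card (verts H)"
    and card_edges: "int (card (edges H)) = a * int (card (verts H)) - b + 1"
    and x_in_verts: "x \<in> verts H"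
    and degree_x: "int (card (neighbors H x)) = a + 1"
    and small_complete: "\<And>j. 2 \<le> j \<Longrightarrow> j < card (verts H) \<Longrightarrow> int (j choose 2) \<le> a * int j - b"
begin

sublocale count_params a b n for n
  using a_nonneg small_complete[of 2] card_verts by unfold_locales auto

lemma finite_verts: "finite (verts H)"
  using card_verts by (auto intro: card_ge_0_finite)

lemma copy_is_circuit:
  assumes "X \<in> copies H n"
  shows "is_circuit (edges (complete_graph n)) (count_matroid a b n) X"
proof -
  obtain V where V: "V \<subseteq> {..<n}" "card V = card (verts H)" "X \<subseteq> all_edges V"
    "card X = card (edges H)"
    using copy_obtain_verts[OF simple_H assms] .
  show ?thesis
  proof (rule is_circuit_sparse[OF V(1) _ V(3)])
    show "2 \<le> card V"
      using card_verts V(2) by simp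
    show "int (card X) = a * int (card V) - b + 1"
      using card_edges V(2,4) by simp
    show "int (j choose 2) \<le> a * int j - b" if "2 \<le> j" "j < card V" for j
      using that small_complete V(2) by simp
  qed
qed

lemma H_matroid_count: "H_matroid H n (count_matroid a b n)"
  using matroid_sparse copy_is_circuit by (simp add: H_matroid_def del: edges_complete_graph)

lemma saturation_insert_vertex:
  assumes V: "V \<subseteq> {..<n}" "card (verts H) \<le> Suc (card V)" and v: "v \<in> {..<n} - V"
    and T: "T \<subseteq> V" "int (card T) = a" and Z: "all_edges V \<subseteq> saturation (copies H n) Z"
  shows "all_edges (insert v V) \<subseteq> saturation (copies H n) (Z \<union> star v T)"
proof -
  let ?sat = "saturation (copies H n) (Z \<union> star v T)"
  have "all_edges V \<subseteq> ?sat"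
    using Z saturation_mono[of Z "Z \<union> star v T"] by blast
  moreover have star_T: "star v T \<subseteq> ?sat"
    by (auto intro: saturation.base)
  moreover have "{v, w} \<in> ?sat" if w: "w \<in> V - T" for w
  proof -
    have "finite T"
      using V(1) T(1) finite_subset by (metis finite_lessThan)
    then have "card (insert w T) = card (neighbors H x)"
      using w T(2) degree_x by simp
    then obtain X where X: "X \<in> copies H n" "star v (insert w T) \<subseteq> X"
      "X \<subseteq> all_edges V \<union> star v (insert w T)"
      using exists_copy_at_new_vertex[OF simple_H finite_verts x_in_verts V v, of "insert w T"]
        w T(1) by auto
    then have rest: "X - {{v, w}} \<subseteq> ?sat"
      using \<open>all_edges V \<subseteq> ?sat\<close> star_T by (auto simp: star_def)
    show ?thesis
    proof (rule saturation.step[OF X(1)])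
      show "{v, w} \<in> X"
        using X(2) by (auto simp: star_def)
      show "d \<in> ?sat" if "d \<in> X" "d \<noteq> {v, w}" for d
        using that rest by blast
    qed
  qed
  ultimately show ?thesis
    using v by (auto simp: all_edges_insert star_def)
qed

lemma degree_less_card_verts: "a + 1 < int (card (verts H))"
proof -
  have "card (neighbors H x) \<le> card (verts H - {x})"
    using neighbors_subset[OF simple_H] finite_verts by (intro card_mono) auto
  then show ?thesis
    using degree_x card_verts x_in_verts by simp
qed

lemma exists_saturation_insert_vertex:
  assumes V: "V \<subseteq> {..<n}" "card (verts H) \<le> Suc (card V)" and v: "v \<in> {..<n} - V"
    and Z: "Z \<subseteq> all_edges V" "all_edges V \<subseteq> saturation (copies H n) Z"
  shows "\<exists>Z'\<subseteq>all_edges (insert v V). int (card Z') \<le> int (card Z) + a \<and>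
    all_edges (insert v V) \<subseteq> saturation (copies H n) Z'"
proof -
  have "nat a \<le> card V"
    using degree_less_card_verts V(2) by simp
  then obtain T where T: "T \<subseteq> V" "card T = nat a" "finite T"
    by (rule obtain_subset_with_card_n)
  have "card (Z \<union> star v T) \<le> card Z + card T"
    using card_Un_le[of Z "star v T"] card_image_le[OF T(3), of "\<lambda>w. {v, w}"]
    by (simp add: star_def)
  then have "int (card (Z \<union> star v T)) \<le> int (card Z) + a"
    using T(2) a_nonneg by simp
  moreover have "Z \<union> star v T \<subseteq> all_edges (insert v V)"
    using Z(1) T(1) v by (auto simp: all_edges_insert star_def)
  moreover have "all_edges (insert v V) \<subseteq> saturation (copies H n) (Z \<union> star v T)"
    using T(2) a_nonneg by (intro saturation_insert_vertex[OF V v T(1) _ Z(2)]) simp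
  ultimately show ?thesis
    by blast
qed

lemma exists_saturation_all_edges:
  assumes "V \<subseteq> {..<n}" "2 \<le> card V"
  shows "\<exists>Z\<subseteq>all_edges V. int (card Z) \<le> a * int (card V) - b \<and>
    all_edges V \<subseteq> saturation (copies H n) Z"
  using finite_subset[OF assms(1) finite_lessThan] assms
proof (induction V rule: finite_induct)
  case empty
  then show ?case by simp
next
  case (insert v V)
  show ?case
  proof (cases "card (insert v V) < card (verts H)")
    case True
    then have "int (card (all_edges (insert v V))) \<le> a * int (card (insert v V)) - b"
      using insert.hyps insert.prems small_complete[of "card (insert v V)"]
      by (simp add: card_all_edges)
    then show ?thesis
      by (intro exI[of _ "all_edges (insert v V)"]) (auto intro: saturation.base)
  next
    case False
    then have large: "card (verts H) \<le> Suc (card V)"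
      using insert.hyps by simp
    then obtain Z where Z: "Z \<subseteq> all_edges V" "int (card Z) \<le> a * int (card V) - b"
      "all_edges V \<subseteq> saturation (copies H n) Z"
      using insert card_verts by auto
    obtain Z' where "Z' \<subseteq> all_edges (insert v V)" "int (card Z') \<le> int (card Z) + a"
      "all_edges (insert v V) \<subseteq> saturation (copies H n) Z'"
      using exists_saturation_insert_vertex[OF _ large _ Z(1,3), of v] insert by auto
    then show ?thesis
      using Z(2) insert.hyps by (intro exI[of _ Z']) (simp add: algebra_simps)
  qed
qed

lemma exists_saturation_block_edges:
  assumes B: "count_matroid a b n B"
  shows "\<exists>Z\<subseteq>all_edges {..<n}. card Z \<le> card B \<and>
    B \<union> block_edges n B \<subseteq> saturation (copies H n) Z"
proof -
  let ?U = "block_edges n B"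
  have block: "V \<subseteq> {..<n}" "2 \<le> card V" if "V \<in> blocks n B" for V
    using blocks_tight[OF that] by (auto simp: tight_def)
  obtain \<zeta> where \<zeta>: "\<And>V. V \<in> blocks n B \<Longrightarrow> \<zeta> V \<subseteq> all_edges V"
    "\<And>V. V \<in> blocks n B \<Longrightarrow> int (card (\<zeta> V)) \<le> a * int (card V) - b"
    "\<And>V. V \<in> blocks n B \<Longrightarrow> all_edges V \<subseteq> saturation (copies H n) (\<zeta> V)"
    using exists_saturation_all_edges[OF block] by metis
  define Z where "Z = (B - ?U) \<union> (\<Union>V\<in>blocks n B. \<zeta> V)"
  have "card Z \<le> card (B - ?U) + card (\<Union>V\<in>blocks n B. \<zeta> V)"
    unfolding Z_def by (rule card_Un_le)
  also have "\<dots> \<le> card (B - ?U) + card (B \<inter> ?U)"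
    using card_UN_blocks_le[OF B \<zeta>(2)] by simp
  also have "\<dots> = card B"
    using card_Int_Diff[OF sparse_finite[OF B], of ?U] by simp
  finally have "card Z \<le> card B" .
  moreover have "\<zeta> V \<subseteq> all_edges {..<n}" if "V \<in> blocks n B" for V
    using \<zeta>(1)[OF that] all_edges_mono[OF block(1)[OF that]] by blast
  then have "Z \<subseteq> all_edges {..<n}"
    using sparse_subset_all_edges[OF B] by (auto simp: Z_def)
  moreover have "all_edges V \<subseteq> saturation (copies H n) Z" if "V \<in> blocks n B" for V
    using \<zeta>(3)[OF that] saturation_mono[of "\<zeta> V" Z] that by (auto simp: Z_def)
  then have "?U \<subseteq> saturation (copies H n) Z"
    by (auto simp: block_edges_def)
  then have "B \<union> ?U \<subseteq> saturation (copies H n) Z"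
    by (auto simp: Z_def intro: saturation.base)
  ultimately show ?thesis
    by blast
qed

lemma finite_saturation_copies:
  assumes "Z \<subseteq> edges (complete_graph n)"
  shows "finite (saturation (copies H n) Z)"
proof (rule finite_subset)
  show "saturation (copies H n) Z \<subseteq> edges (complete_graph n)"
  proof (rule saturation_least[OF assms])
    show "e \<in> edges (complete_graph n)" if "X \<in> copies H n" "e \<in> X" for X e
      using copy_is_circuit[OF that(1)] that(2) unfolding is_circuit_def by blast
  qed
  show "finite (edges (complete_graph n))"
    by (simp add: finite_all_edges)
qed

lemma exists_seq_val_le_rank:
  assumes F: "F \<subseteq> edges (complete_graph n)"
  shows "\<exists>S. proper_seq (copies H n) S \<and>
    seq_val F S \<le> int (matroid_rank (count_matroid a b n) F)"
proof -
  interpret count: matroid "edges (complete_graph n)" "count_matroid a b n"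
    by (rule matroid_sparse)
  obtain B where B: "B \<subseteq> F" "count_matroid a b n B" "card B = count.rank F"
    using count.obtain_basis_extending[OF count.indep_empty empty_subsetI] .
  obtain Z where Z: "Z \<subseteq> edges (complete_graph n)" "card Z \<le> card B"
    "B \<union> block_edges n B \<subseteq> saturation (copies H n) Z"
    using exists_saturation_block_edges[OF B(2)] by auto
  have "F \<subseteq> saturation (copies H n) Z"
    using basis_diff_subset_block_edges[OF _ B] F Z(3) by auto
  then obtain S where "proper_seq (copies H n) S" "seq_val F S \<le> int (card Z)"
    using exists_proper_seq_seq_val_le[OF finite_saturation_copies[OF Z(1)]] by auto
  then show ?thesis
    using Z(2) B(3) by (intro exI[of _ S]) auto
qed

theorem count_matroid_unique_maximal_and_rank:
  "unique_maximal_H_matroid H n (count_matroid a b n) \<and>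
    rank_function_is n (count_matroid a b n) (val_H H n)"
  using H_matroid_count exists_seq_val_le_rank
  by (intro conjI unique_maximal_H_matroid_if_rank_attained rank_function_is_val_H_if_rank_attained)

end

section \<open>The five count matroids\<close>

lemma count_generating_graph_complete:
  assumes "3 \<le> m" "a = int m - 2" "int (m choose 2) = a * int m - b + 1"
    and "\<And>j. 2 \<le> j \<Longrightarrow> j < m \<Longrightarrow> int (j choose 2) \<le> a * int j - b"
  shows "count_generating_graph a b (complete_graph m) 0"
proof
  have "neighbors (complete_graph m) 0 = {1..<m}"
    using assms(1) by (auto simp: neighbors_def doubleton_in_all_edges_iff)
  then show "int (card (neighbors (complete_graph m) 0)) = a + 1"
    using assms by simp
qed (use assms in \<open>auto simp: simple_graph_iff card_all_edges\<close>)

lemma count_generating_graph_complete_minus_edge: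
  assumes "4 \<le> m" "a = int m - 3" "int (m choose 2) = a * int m - b + 2"
    and "\<And>j. 2 \<le> j \<Longrightarrow> j < m \<Longrightarrow> int (j choose 2) \<le> a * int j - b"
  shows "count_generating_graph a b (complete_graph_minus_edge m) 0"
proof
  let ?H = "complete_graph_minus_edge m"
  have H: "verts ?H = {..<m}" "edges ?H = all_edges {..<m} - {{0, 1}}"
    by (simp_all add: complete_graph_minus_edge_def)
  have "neighbors ?H 0 = {2..<m}"
    using assms(1) by (auto simp: neighbors_def H doubleton_in_all_edges_iff doubleton_eq_iff)
  then show "int (card (neighbors ?H 0)) = a + 1"
    using assms by simp
  have "{0, 1} \<in> all_edges {..<m}"
    using assms(1) by (simp add: doubleton_in_all_edges_iff)
  then have "card (all_edges {..<m}) = Suc (card (edges ?H))"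
    unfolding H by (intro card.remove finite_all_edges) auto
  then show "int (card (edges ?H)) = a * int (card (verts ?H)) - b + 1"
    using assms(3) by (simp add: H card_all_edges)
  show "simple_graph ?H" "2 < card (verts ?H)" "0 \<in> verts ?H" "0 \<le> a"
    using assms by (auto simp: simple_graph_iff H)
  show "int (j choose 2) \<le> a * int j - b" if "2 \<le> j" "j < card (verts ?H)" for j
    using that assms(4) by (simp add: H)
qed

theorem theorem4p3:
  fixes n :: nat
  shows "(n \<ge> 3 \<longrightarrow> unique_maximal_H_matroid (complete_graph 3) n (count_matroid 1 1 n) \<and>
            rank_function_is n (count_matroid 1 1 n) (val_H (complete_graph 3) n)) \<and>
         (n \<ge> 4 \<longrightarrow> unique_maximal_H_matroid (complete_graph 4) n (count_matroid 2 3 n) \<and>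
            rank_function_is n (count_matroid 2 3 n) (val_H (complete_graph 4) n)) \<and>
         (n \<ge> 4 \<longrightarrow> unique_maximal_H_matroid (complete_graph_minus_edge 4) n (count_matroid 1 0 n) \<and>
            rank_function_is n (count_matroid 1 0 n) (val_H (complete_graph_minus_edge 4) n)) \<and>
         (n \<ge> 5 \<longrightarrow> unique_maximal_H_matroid (complete_graph_minus_edge 5) n (count_matroid 2 2 n) \<and>
            rank_function_is n (count_matroid 2 2 n) (val_H (complete_graph_minus_edge 5) n)) \<and>
         (n \<ge> 6 \<longrightarrow> unique_maximal_H_matroid (complete_graph_minus_edge 6) n (count_matroid 3 5 n) \<and>
            rank_function_is n (count_matroid 3 5 n) (val_H (complete_graph_minus_edge 6) n))"
proof -
  interpret K3: count_generating_graph 1 1 "complete_graph 3" 0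
    by (rule count_generating_graph_complete) (auto simp: less_Suc_eq eval_nat_numeral)
  interpret K4: count_generating_graph 2 3 "complete_graph 4" 0
    by (rule count_generating_graph_complete) (auto simp: less_Suc_eq eval_nat_numeral)
  interpret K4_minus: count_generating_graph 1 0 "complete_graph_minus_edge 4" 0
    by (rule count_generating_graph_complete_minus_edge) (auto simp: less_Suc_eq eval_nat_numeral)
  interpret K5_minus: count_generating_graph 2 2 "complete_graph_minus_edge 5" 0
    by (rule count_generating_graph_complete_minus_edge) (auto simp: less_Suc_eq eval_nat_numeral)
  interpret K6_minus: count_generating_graph 3 5 "complete_graph_minus_edge 6" 0
    by (rule count_generating_graph_complete_minus_edge) (auto simp: less_Suc_eq eval_nat_numeral)
  show ?thesis
    using K3.count_matroid_unique_maximal_and_rank K4.count_matroid_unique_maximal_and_rank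
      K4_minus.count_matroid_unique_maximal_and_rank K5_minus.count_matroid_unique_maximal_and_rank
      K6_minus.count_matroid_unique_maximal_and_rank
    by blast
qed

end
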